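(* Let $\mathbb K$ be a commutative unital ring, $(U,V)$ a linear set and $n\in\mathbb N$. The $n$-fold tangent bundle $\mathsf T^{\mathsf n}U:=\mathsf{Gsy}^{\mathsf n}_{(0,\dots,0)}U$ is a symmetric $n$-fold vector bundle, i.e. it is an edge-symmetric $n$-fold groupoid such that, for each edge, the source and target projections coincide, and each vertex group (isotropy group of an edge groupoid) carries moreover a $\mathbb K$-module structure.
   Context: A linear set is a pair $(U,V)$, $V$ a $\mathbb K$-module, $U\subset V$. Groupoids have source $\pi_0$, target $\pi_1$, product $g'*g$ defined iff $\pi_1(g)=\pi_0(g')$. An $n$-fold groupoid is a family of sets $(C_\alpha)_{\alpha\subset\{1,\dots,n\}}$ with, for each edge $(\beta,\alpha=\beta\cup\{i\})$, $i\notin\beta$, a groupoid with morphisms $C_\alpha$ and objects $C_\beta$, such that each face gives a double groupoid. It is edge-symmetric if the symmetric group $S_n$ acts by isomorphisms of $n$-fold groupoids $f_\tau:C\to C^\tau$, where $C^\tau=(C_{\tau(\alpha)})_\alpha$. For $\mathbf t\in\mathbb K^n$, $\mathsf{Gsy}^{\mathsf n}_{\mathbf t}U$ is the $n$-fold groupoid with vertex sets $\{(v_\beta)_{\beta\subset\alpha}\in\prod_{\beta\subset\alpha}V:\forall\beta\subset\alpha,\ \sum_{\gamma\subset\beta}(\prod_{j\in\gamma}t_j)v_\gamma\in U\}$, and, for the edge $(\beta,\alpha=\beta\cup\{i\})$: $\pi_0(\mathbf v)=(v_\gamma)_{\gamma\subset\beta}$, $\pi_1(\mathbf v)=(v_\gamma+t_iv_{\gamma\cup\{i\}})_{\gamma\subset\beta}$,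 units given by extension by $0$, and $\mathbf v'*\mathbf v=\mathbf w$ with $w_\gamma=v_\gamma$, $w_{\gamma\cup\{i\}}=v_{\gamma\cup\{i\}}+v'_{\gamma\cup\{i\}}$ for $\gamma\subset\beta$. (The empty product is $1$, so for $\mathbf t=0$ the vertex set at $\alpha$ is $U\times\prod_{\emptyset\ne\beta\subset\alpha}V$.) *)

theory Defs
  imports "HOL-Algebra.Module" "HOL-Combinatorics.Permutations"
begin

section \<open>Linear sets\<close>

definition linear_set :: "('k, 'm) ring_scheme \<Rightarrow> ('k, 'v, 'n) module_scheme \<Rightarrow> 'v set \<Rightarrow> bool" where
  "linear_set R M U \<longleftrightarrow> module R M \<and> U \<subseteq> carrier M"

section \<open>Groupoids\<close>

text \<open>\<open>gsrc\<close> and \<open>gtrg\<close> are the projections \<open>\<pi>\<^sub>0\<close> and \<open>\<pi>\<^sub>1\<close>. The product \<open>gcomp G g' g\<close> is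
  meaningful only if \<open>gtrg G g = gsrc G g'\<close>; its values elsewhere are irrelevant.\<close>

record 'a groupoid =
  Mor :: "'a set"
  Obj :: "'a set"
  gsrc :: "'a \<Rightarrow> 'a"
  gtrg :: "'a \<Rightarrow> 'a"
  gunit :: "'a \<Rightarrow> 'a"
  gcomp :: "'a \<Rightarrow> 'a \<Rightarrow> 'a"

definition is_groupoid :: "'a groupoid \<Rightarrow> bool" where
  "is_groupoid G \<longleftrightarrow>
     gsrc G \<in> Mor G \<rightarrow> Obj G \<and> gtrg G \<in> Mor G \<rightarrow> Obj G \<and> gunit G \<in> Obj G \<rightarrow> Mor G \<and>
     (\<forall>x\<in>Obj G. gsrc G (gunit G x) = x \<and> gtrg G (gunit G x) = x) \<and>
     (\<forall>g'\<in>Mor G. \<forall>g\<in>Mor G. gtrg G g = gsrc G g' \<longrightarrow>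
        gcomp G g' g \<in> Mor G \<and>
        gsrc G (gcomp G g' g) = gsrc G g \<and> gtrg G (gcomp G g' g) = gtrg G g') \<and>
     (\<forall>g''\<in>Mor G. \<forall>g'\<in>Mor G. \<forall>g\<in>Mor G. gtrg G g = gsrc G g' \<and> gtrg G g' = gsrc G g'' \<longrightarrow>
        gcomp G g'' (gcomp G g' g) = gcomp G (gcomp G g'' g') g) \<and>
     (\<forall>g\<in>Mor G. gcomp G g (gunit G (gsrc G g)) = g \<and> gcomp G (gunit G (gtrg G g)) g = g) \<and>
     (\<forall>g\<in>Mor G. \<exists>h\<in>Mor G. gsrc G h = gtrg G g \<and> gtrg G h = gsrc G g \<and>
        gcomp G h g = gunit G (gsrc G g) \<and> gcomp G g h = gunit G (gtrg G g))"

text \<open>A morphism is a pair consisting of a map \<open>F\<close> on morphisms and a map \<open>f\<close> on objects.\<close>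

definition groupoid_hom ::
    "'a groupoid \<Rightarrow> 'b groupoid \<Rightarrow> ('a \<Rightarrow> 'b) \<Rightarrow> ('a \<Rightarrow> 'b) \<Rightarrow> bool" where
  "groupoid_hom G H F f \<longleftrightarrow>
     F \<in> Mor G \<rightarrow> Mor H \<and> f \<in> Obj G \<rightarrow> Obj H \<and>
     (\<forall>g\<in>Mor G. gsrc H (F g) = f (gsrc G g) \<and> gtrg H (F g) = f (gtrg G g)) \<and>
     (\<forall>x\<in>Obj G. F (gunit G x) = gunit H (f x)) \<and>
     (\<forall>g'\<in>Mor G. \<forall>g\<in>Mor G. gtrg G g = gsrc G g' \<longrightarrow>
        F (gcomp G g' g) = gcomp H (F g') (F g))"

definition vertex_group :: "'a groupoid \<Rightarrow> 'a \<Rightarrow> 'a monoid" where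
  "vertex_group G x =
     \<lparr>carrier = {g \<in> Mor G. gsrc G g = x \<and> gtrg G g = x}, monoid.mult = gcomp G, one = gunit G x\<rparr>"

section \<open>Double groupoids\<close>

text \<open>A square of groupoids
    \<open>V1\<close> : \<open>C11\<close> over \<open>C01\<close>, \<open>V0\<close> : \<open>C10\<close> over \<open>C00\<close> (one direction),
    \<open>H1\<close> : \<open>C11\<close> over \<open>C10\<close>, \<open>H0\<close> : \<open>C01\<close> over \<open>C00\<close> (other direction)
  is a double groupoid if the structure maps of either direction are morphisms with respect to the
  groupoids of the other direction. For the product this means that it is a morphism on
  the groupoid of composable pairs below, which includes the interchange law.\<close>

definition composable_pairs ::
    "'a groupoid \<Rightarrow> 'a groupoid \<Rightarrow> 'a groupoid \<Rightarrow> 'a groupoid \<Rightarrow> ('a \<times> 'a) groupoid" where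
  "composable_pairs V1 V0 H1 H0 =
     \<lparr>Mor = {(g', g). g' \<in> Mor H1 \<and> g \<in> Mor H1 \<and> gtrg H1 g = gsrc H1 g'},
      Obj = {(x', x). x' \<in> Mor H0 \<and> x \<in> Mor H0 \<and> gtrg H0 x = gsrc H0 x'},
      gsrc = map_prod (gsrc V1) (gsrc V1),
      gtrg = map_prod (gtrg V1) (gtrg V1),
      gunit = map_prod (gunit V1) (gunit V1),
      gcomp = (\<lambda>(h', h) (g', g). (gcomp V1 h' g', gcomp V1 h g))\<rparr>"

definition structure_maps_hom ::
    "'a groupoid \<Rightarrow> 'a groupoid \<Rightarrow> 'a groupoid \<Rightarrow> 'a groupoid \<Rightarrow> bool" where
  "structure_maps_hom V1 V0 H1 H0 \<longleftrightarrow>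
     groupoid_hom V1 V0 (gsrc H1) (gsrc H0) \<and>
     groupoid_hom V1 V0 (gtrg H1) (gtrg H0) \<and>
     groupoid_hom V0 V1 (gunit H1) (gunit H0) \<and>
     groupoid_hom (composable_pairs V1 V0 H1 H0) V1
       (\<lambda>(g', g). gcomp H1 g' g) (\<lambda>(x', x). gcomp H0 x' x)"

definition double_groupoid ::
    "'a groupoid \<Rightarrow> 'a groupoid \<Rightarrow> 'a groupoid \<Rightarrow> 'a groupoid \<Rightarrow> bool" where
  "double_groupoid V1 V0 H1 H0 \<longleftrightarrow>
     is_groupoid V1 \<and> is_groupoid V0 \<and> is_groupoid H1 \<and> is_groupoid H0 \<and>
     Mor V1 = Mor H1 \<and> Obj V1 = Mor H0 \<and> Mor V0 = Obj H1 \<and> Obj V0 = Obj H0 \<and>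
     structure_maps_hom V1 V0 H1 H0 \<and> structure_maps_hom H1 H0 V1 V0"

section \<open>\<open>n\<close>-fold groupoids\<close>

text \<open>\<open>edge C \<beta> i\<close> is the groupoid of the edge \<open>(\<beta>, \<beta> \<union> {i})\<close>. Only the values of \<open>vertex\<close> and
  \<open>edge\<close> at \<open>\<beta> \<subseteq> {1..n}\<close> and \<open>i \<in> {1..n} - \<beta>\<close> are relevant.\<close>

record 'a multi_groupoid =
  vertex :: "nat set \<Rightarrow> 'a set"
  edge :: "nat set \<Rightarrow> nat \<Rightarrow> 'a groupoid"

definition n_fold_groupoid :: "nat \<Rightarrow> 'a multi_groupoid \<Rightarrow> bool" where
  "n_fold_groupoid n C \<longleftrightarrow>
     (\<forall>\<beta> i. \<beta> \<subseteq> {1..n} \<and> i \<in> {1..n} - \<beta> \<longrightarrow>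
        is_groupoid (edge C \<beta> i) \<and>
        Mor (edge C \<beta> i) = vertex C (insert i \<beta>) \<and> Obj (edge C \<beta> i) = vertex C \<beta>) \<and>
     (\<forall>\<beta> i j. \<beta> \<subseteq> {1..n} \<and> i \<in> {1..n} - \<beta> \<and> j \<in> {1..n} - \<beta> \<and> i \<noteq> j \<longrightarrow>
        double_groupoid (edge C (insert j \<beta>) i) (edge C \<beta> i)
                        (edge C (insert i \<beta>) j) (edge C \<beta> j))"

definition n_fold_iso ::
    "nat \<Rightarrow> 'a multi_groupoid \<Rightarrow> 'b multi_groupoid \<Rightarrow> (nat set \<Rightarrow> 'a \<Rightarrow> 'b) \<Rightarrow> bool" where
  "n_fold_iso n C D F \<longleftrightarrow>
     (\<forall>\<alpha>. \<alpha> \<subseteq> {1..n} \<longrightarrow> bij_betw (F \<alpha>) (vertex C \<alpha>) (vertex D \<alpha>)) \<and>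
     (\<forall>\<beta> i. \<beta> \<subseteq> {1..n} \<and> i \<in> {1..n} - \<beta> \<longrightarrow>
        groupoid_hom (edge C \<beta> i) (edge D \<beta> i) (F (insert i \<beta>)) (F \<beta>))"

definition permuted :: "(nat \<Rightarrow> nat) \<Rightarrow> 'a multi_groupoid \<Rightarrow> 'a multi_groupoid" where
  "permuted \<tau> C = \<lparr>vertex = (\<lambda>\<alpha>. vertex C (\<tau> ` \<alpha>)), edge = (\<lambda>\<beta> i. edge C (\<tau> ` \<beta>) (\<tau> i))\<rparr>"

text \<open>Since \<open>f \<tau>\<close> maps the vertex set at \<open>\<alpha>\<close> to the one at \<open>\<tau> ` \<alpha>\<close>, the composite of
  \<open>f \<tau>\<close> and \<open>f \<sigma>\<close> at \<open>\<alpha>\<close> is \<open>f \<sigma> (\<tau> ` \<alpha>) \<circ> f \<tau> \<alpha>\<close>.\<close>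

definition edge_symmetric :: "nat \<Rightarrow> 'a multi_groupoid \<Rightarrow> bool" where
  "edge_symmetric n C \<longleftrightarrow>
     (\<exists>f :: (nat \<Rightarrow> nat) \<Rightarrow> nat set \<Rightarrow> 'a \<Rightarrow> 'a.
        (\<forall>\<tau>. \<tau> permutes {1..n} \<longrightarrow> n_fold_iso n C (permuted \<tau> C) (f \<tau>)) \<and>
        (\<forall>\<alpha>. \<alpha> \<subseteq> {1..n} \<longrightarrow> (\<forall>x\<in>vertex C \<alpha>. f id \<alpha> x = x)) \<and>
        (\<forall>\<sigma> \<tau> \<alpha>. \<sigma> permutes {1..n} \<and> \<tau> permutes {1..n} \<and> \<alpha> \<subseteq> {1..n} \<longrightarrow>
           (\<forall>x\<in>vertex C \<alpha>. f (\<sigma> \<circ> \<tau>) \<alpha> x = f \<sigma> (\<tau> ` \<alpha>) (f \<tau> \<alpha> x))))"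

text \<open>The additive group of the module is the given group; only the scalar multiplication is
  additional structure.\<close>

definition carries_module :: "('k, 'm) ring_scheme \<Rightarrow> 'a monoid \<Rightarrow> bool" where
  "carries_module R A \<longleftrightarrow> (\<exists>M :: ('k, 'a) module. module R M \<and>
     carrier M = carrier A \<and> add M = monoid.mult A \<and> zero M = one A)"

definition symmetric_n_fold_vector_bundle ::
    "('k, 'm) ring_scheme \<Rightarrow> nat \<Rightarrow> 'a multi_groupoid \<Rightarrow> bool" where
  "symmetric_n_fold_vector_bundle R n C \<longleftrightarrow>
     n_fold_groupoid n C \<and> edge_symmetric n C \<and>
     (\<forall>\<beta> i. \<beta> \<subseteq> {1..n} \<and> i \<in> {1..n} - \<beta> \<longrightarrow>
        (\<forall>g\<in>Mor (edge C \<beta> i). gsrc (edge C \<beta> i) g = gtrg (edge C \<beta> i) g) \<and>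
        (\<forall>x\<in>Obj (edge C \<beta> i). carries_module R (vertex_group (edge C \<beta> i) x)))"

section \<open>The groupoids \<open>Gsy\<close> and the \<open>n\<close>-fold tangent bundle\<close>

text \<open>A family \<open>(v\<^sub>\<beta>)\<close> indexed by \<open>\<beta> \<subseteq> \<alpha>\<close> is an extensional function on \<open>Pow \<alpha>\<close>. The number \<open>n\<close>
  enters only through the index sets \<open>\<alpha> \<subseteq> {1..n}\<close>, hence it is not a parameter of these
  definitions.\<close>

definition gsy_set ::
    "('k, 'm) ring_scheme \<Rightarrow> ('k, 'v, 'n) module_scheme \<Rightarrow> 'v set \<Rightarrow> (nat \<Rightarrow> 'k)
       \<Rightarrow> nat set \<Rightarrow> (nat set \<Rightarrow> 'v) set" where
  "gsy_set R M U t \<alpha> =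
     {v \<in> Pow \<alpha> \<rightarrow>\<^sub>E carrier M.
        \<forall>\<beta>. \<beta> \<subseteq> \<alpha> \<longrightarrow>
          (\<Oplus>\<^bsub>M\<^esub>\<gamma>\<in>Pow \<beta>. (\<Otimes>\<^bsub>R\<^esub>j\<in>\<gamma>. t j) \<odot>\<^bsub>M\<^esub> v \<gamma>) \<in> U}"

definition gsy_edge ::
    "('k, 'm) ring_scheme \<Rightarrow> ('k, 'v, 'n) module_scheme \<Rightarrow> 'v set \<Rightarrow> (nat \<Rightarrow> 'k)
       \<Rightarrow> nat set \<Rightarrow> nat \<Rightarrow> (nat set \<Rightarrow> 'v) groupoid" where
  "gsy_edge R M U t \<beta> i =
     \<lparr>Mor = gsy_set R M U t (insert i \<beta>),
      Obj = gsy_set R M U t \<beta>,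
      gsrc = (\<lambda>v. \<lambda>\<gamma>\<in>Pow \<beta>. v \<gamma>),
      gtrg = (\<lambda>v. \<lambda>\<gamma>\<in>Pow \<beta>. v \<gamma> \<oplus>\<^bsub>M\<^esub> t i \<odot>\<^bsub>M\<^esub> v (insert i \<gamma>)),
      gunit = (\<lambda>v. \<lambda>\<gamma>\<in>Pow (insert i \<beta>). if \<gamma> \<subseteq> \<beta> then v \<gamma> else \<zero>\<^bsub>M\<^esub>),
      gcomp = (\<lambda>v' v. \<lambda>\<gamma>\<in>Pow (insert i \<beta>). if \<gamma> \<subseteq> \<beta> then v \<gamma> else v \<gamma> \<oplus>\<^bsub>M\<^esub> v' \<gamma>)\<rparr>"

definition Gsy ::
    "('k, 'm) ring_scheme \<Rightarrow> ('k, 'v, 'n) module_scheme \<Rightarrow> 'v set \<Rightarrow> (nat \<Rightarrow> 'k)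
       \<Rightarrow> (nat set \<Rightarrow> 'v) multi_groupoid" where
  "Gsy R M U t = \<lparr>vertex = gsy_set R M U t, edge = gsy_edge R M U t\<rparr>"

definition tangent_bundle ::
    "('k, 'm) ring_scheme \<Rightarrow> ('k, 'v, 'n) module_scheme \<Rightarrow> 'v set
       \<Rightarrow> (nat set \<Rightarrow> 'v) multi_groupoid" where
  "tangent_bundle R M U = Gsy R M U (\<lambda>_. \<zero>\<^bsub>R\<^esub>)"

end

theory Submission
  imports Defs
begin

text \<open>At \<open>t = 0\<close> the weight of \<open>v\<^sub>\<gamma>\<close> in the condition defining the vertex sets vanishes unless
  \<open>\<gamma> = {}\<close>, so the condition only says that \<open>v\<^sub>\<emptyset>\<close> lies in \<open>U\<close>. Both projections of an edge then
  restrict the family to \<open>Pow \<beta>\<close>, and the product adds the components whose index contains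
  \<open>i\<close>, so all groupoid and interchange laws are componentwise laws of the additive group of
  the module. A permutation \<open>\<tau>\<close> acts by reindexing along preimages of index sets under \<open>\<tau>\<close>.\<close>

text \<open>The groupoid axioms keep projections, units and products inside \<open>Mor G\<close> and
  \<open>Obj G\<close>, where the two pairs of maps agree. This lets the morphism property pass
  between the two projections of an edge, which coincide on the vertex sets only.\<close>

lemma groupoid_hom_cong:
  assumes "groupoid_hom G H F' f'" "is_groupoid G"
    and "\<And>g. g \<in> Mor G \<Longrightarrow> F g = F' g" "\<And>x. x \<in> Obj G \<Longrightarrow> f x = f' x"
  shows "groupoid_hom G H F f"
  using assms unfolding groupoid_hom_def is_groupoid_def
  by (simp add: Pi_iff)

lemma vimage_subset_iff: "bij \<tau> \<Longrightarrow> \<tau> -` \<gamma> \<subseteq> \<alpha> \<longleftrightarrow> \<gamma> \<subseteq> \<tau> ` \<alpha>"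
  by (metis bij_is_inj bij_is_surj image_mono inj_vimage_image_eq surj_image_vimage_eq vimage_mono)

locale module_with_set = module R M
  for R :: "('k, 'm) ring_scheme" (structure) and M :: "('k, 'v, 'n) module_scheme" (structure) +
  fixes U :: "'v set"
begin

section \<open>Vertex sets at t = 0\<close>

abbreviation T :: "nat set \<Rightarrow> (nat set \<Rightarrow> 'v) set" where
  "T \<equiv> gsy_set R M U (\<lambda>_. \<zero>\<^bsub>R\<^esub>)"

abbreviation E :: "nat set \<Rightarrow> nat \<Rightarrow> (nat set \<Rightarrow> 'v) groupoid" where
  "E \<equiv> gsy_edge R M U (\<lambda>_. \<zero>\<^bsub>R\<^esub>)"

text \<open>Finiteness matters because \<open>finprod\<close> over an infinite set defaults to one;
  the empty product is one as well.\<close>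

lemma finprod_zero:
  assumes "finite \<gamma>" "\<gamma> \<noteq> {}"
  shows "(\<Otimes>\<^bsub>R\<^esub>j\<in>\<gamma>. \<zero>\<^bsub>R\<^esub>) = \<zero>\<^bsub>R\<^esub>"
  using assms by (induction rule: finite_ne_induct) simp_all

lemma weighted_sum_zero:
  assumes "finite \<beta>" "\<And>\<gamma>. \<gamma> \<subseteq> \<beta> \<Longrightarrow> v \<gamma> \<in> carrier M"
  shows "(\<Oplus>\<^bsub>M\<^esub>\<gamma>\<in>Pow \<beta>. (\<Otimes>\<^bsub>R\<^esub>j\<in>\<gamma>. \<zero>\<^bsub>R\<^esub>) \<odot>\<^bsub>M\<^esub> v \<gamma>) = v {}"
proof -
  have "(\<Oplus>\<^bsub>M\<^esub>\<gamma>\<in>Pow \<beta>. (\<Otimes>\<^bsub>R\<^esub>j\<in>\<gamma>. \<zero>\<^bsub>R\<^esub>) \<odot>\<^bsub>M\<^esub> v \<gamma>)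
      = (\<Oplus>\<^bsub>M\<^esub>\<gamma>\<in>Pow \<beta>. if {} = \<gamma> then v \<gamma> else \<zero>\<^bsub>M\<^esub>)"
  proof (rule M.finsum_cong')
    fix \<gamma> assume "\<gamma> \<in> Pow \<beta>"
    then show "(\<Otimes>\<^bsub>R\<^esub>j\<in>\<gamma>. \<zero>\<^bsub>R\<^esub>) \<odot>\<^bsub>M\<^esub> v \<gamma> = (if {} = \<gamma> then v \<gamma> else \<zero>\<^bsub>M\<^esub>)"
      using assms finprod_zero[of \<gamma>] finite_subset[of \<gamma> \<beta>] by auto
  qed (use assms in auto)
  also have "\<dots> = v {}"
    using assms by (intro M.finsum_singleton) auto
  finally show ?thesis .
qed

text \<open>The weighted sums for all \<open>\<beta>\<close> have the same value
  \<open>v {}\<close>, so the family of conditions collapses to a single one. Extensionality is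
  spelled out so that later membership proofs are pointwise.\<close>

lemma mem_T_iff:
  assumes "finite \<alpha>"
  shows "v \<in> T \<alpha> \<longleftrightarrow>
    (\<forall>\<gamma>. \<gamma> \<subseteq> \<alpha> \<longrightarrow> v \<gamma> \<in> carrier M) \<and> (\<forall>\<gamma>. \<not> \<gamma> \<subseteq> \<alpha> \<longrightarrow> v \<gamma> = undefined) \<and> v {} \<in> U"
proof -
  have "(\<Oplus>\<^bsub>M\<^esub>\<gamma>\<in>Pow \<beta>. (\<Otimes>\<^bsub>R\<^esub>j\<in>\<gamma>. \<zero>\<^bsub>R\<^esub>) \<odot>\<^bsub>M\<^esub> v \<gamma>) = v {}"
    if "\<beta> \<subseteq> \<alpha>" "v \<in> Pow \<alpha> \<rightarrow>\<^sub>E carrier M" for \<beta>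
    using that assms by (intro weighted_sum_zero) (auto dest: finite_subset)
  then show ?thesis
    unfolding gsy_set_def by (auto simp: PiE_iff extensional_def)
qed

lemma T_memI:
  assumes "finite \<alpha>" "\<And>\<gamma>. \<gamma> \<subseteq> \<alpha> \<Longrightarrow> v \<gamma> \<in> carrier M"
    "\<And>\<gamma>. \<not> \<gamma> \<subseteq> \<alpha> \<Longrightarrow> v \<gamma> = undefined" "v {} \<in> U"
  shows "v \<in> T \<alpha>"
  using assms by (simp add: mem_T_iff)

lemma T_carrier: "v \<in> T \<alpha> \<Longrightarrow> \<gamma> \<subseteq> \<alpha> \<Longrightarrow> v \<gamma> \<in> carrier M"
  by (auto simp: gsy_set_def)

lemma T_undefined: "v \<in> T \<alpha> \<Longrightarrow> \<not> \<gamma> \<subseteq> \<alpha> \<Longrightarrow> v \<gamma> = undefined"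
  by (auto simp: gsy_set_def)

lemma T_base: "finite \<alpha> \<Longrightarrow> v \<in> T \<alpha> \<Longrightarrow> v {} \<in> U"
  by (simp add: mem_T_iff)

section \<open>Edge groupoids at t = 0\<close>

lemma Mor_E [simp]: "Mor (E \<beta> i) = T (insert i \<beta>)"
  and Obj_E [simp]: "Obj (E \<beta> i) = T \<beta>"
  by (simp_all add: gsy_edge_def)

lemma gsrc_E: "gsrc (E \<beta> i) v = restrict v (Pow \<beta>)"
  by (simp add: gsy_edge_def)

text \<open>The displacement term is a zero multiple and vanishes once the components are known to
  lie in the module; hence the membership assumption, in contrast to \<open>gsrc_E\<close>.\<close>

lemma gtrg_E:
  assumes "v \<in> T (insert i \<beta>)"
  shows "gtrg (E \<beta> i) v = restrict v (Pow \<beta>)"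
proof -
  have "v \<gamma> \<in> carrier M" "v (insert i \<gamma>) \<in> carrier M" if "\<gamma> \<subseteq> \<beta>" for \<gamma>
    using that by (auto intro!: T_carrier[OF assms])
  then show ?thesis
    by (auto simp: gsy_edge_def restrict_def)
qed

text \<open>For subsets of \<open>insert i \<beta>\<close>, lying in \<open>\<beta>\<close> is the
  same as avoiding \<open>i\<close>. Testing \<open>i \<in> \<gamma>\<close> instead turns the two
  directions of a square into two separate membership tests.\<close>

lemma gunit_E:
  assumes "i \<notin> \<beta>"
  shows "gunit (E \<beta> i) v =
    (\<lambda>\<gamma>\<in>Pow (insert i \<beta>). if i \<in> \<gamma> then \<zero>\<^bsub>M\<^esub> else v \<gamma>)"
  using assms by (fastforce simp: gsy_edge_def restrict_def)

lemma gcomp_E: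
  assumes "i \<notin> \<beta>"
  shows "gcomp (E \<beta> i) v' v =
    (\<lambda>\<gamma>\<in>Pow (insert i \<beta>). if i \<in> \<gamma> then v \<gamma> \<oplus>\<^bsub>M\<^esub> v' \<gamma> else v \<gamma>)"
  using assms by (fastforce simp: gsy_edge_def restrict_def)

lemma restrict_T:
  assumes "v \<in> T \<alpha>" "\<beta> \<subseteq> \<alpha>" "finite \<alpha>"
  shows "restrict v (Pow \<beta>) \<in> T \<beta>"
  using assms by (auto simp: mem_T_iff finite_subset)

lemma gunit_T:
  assumes "i \<notin> \<beta>" "finite \<beta>" "v \<in> T \<beta>"
  shows "gunit (E \<beta> i) v \<in> T (insert i \<beta>)"
  using assms T_base[OF assms(2,3)] T_carrier[OF assms(3)]
  by (intro T_memI) (auto simp: gunit_E subset_insert)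

lemma gcomp_T:
  assumes "i \<notin> \<beta>" "finite \<beta>" "v \<in> T (insert i \<beta>)" "v' \<in> T (insert i \<beta>)"
  shows "gcomp (E \<beta> i) v' v \<in> T (insert i \<beta>)"
  using assms T_base[OF _ assms(3)] T_carrier[OF assms(3)] T_carrier[OF assms(4)]
  by (intro T_memI) (auto simp: gcomp_E)

lemma composable_E_iff:
  assumes "v \<in> T (insert i \<beta>)"
  shows "gtrg (E \<beta> i) v = gsrc (E \<beta> i) v' \<longleftrightarrow> (\<forall>\<gamma>. \<gamma> \<subseteq> \<beta> \<longrightarrow> v \<gamma> = v' \<gamma>)"
  using assms by (auto simp: gtrg_E gsrc_E fun_eq_iff restrict_def)

lemma is_groupoid_E:
  assumes "i \<notin> \<beta>" "finite \<beta>"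
  shows "is_groupoid (E \<beta> i)"
proof -
  have notin: "i \<notin> \<gamma>" "\<gamma> \<subseteq> insert i \<beta>" if "\<gamma> \<subseteq> \<beta>" for \<gamma>
    using that assms(1) by auto
  show ?thesis
    unfolding is_groupoid_def Mor_E Obj_E
  proof (intro conjI ballI impI)
    show "gsrc (E \<beta> i) \<in> T (insert i \<beta>) \<rightarrow> T \<beta>" "gtrg (E \<beta> i) \<in> T (insert i \<beta>) \<rightarrow> T \<beta>"
      using assms by (auto simp: gsrc_E gtrg_E intro: restrict_T[of _ "insert i \<beta>"])
    show "gunit (E \<beta> i) \<in> T \<beta> \<rightarrow> T (insert i \<beta>)"
      using assms by (auto intro: gunit_T)
  next
    fix x assume x: "x \<in> T \<beta>"
    have "restrict (gunit (E \<beta> i) x) (Pow \<beta>) = x"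
      using notin T_undefined[OF x] by (simp add: gunit_E[OF assms(1)] fun_eq_iff) metis
    then show "gsrc (E \<beta> i) (gunit (E \<beta> i) x) = x" "gtrg (E \<beta> i) (gunit (E \<beta> i) x) = x"
      using assms x by (auto simp: gsrc_E gtrg_E gunit_T)
  next
    fix g' g assume g: "g' \<in> T (insert i \<beta>)" "g \<in> T (insert i \<beta>)"
      and "gtrg (E \<beta> i) g = gsrc (E \<beta> i) g'"
    then have eq: "\<And>\<gamma>. \<gamma> \<subseteq> \<beta> \<Longrightarrow> g \<gamma> = g' \<gamma>"
      by (simp add: composable_E_iff)
    show c: "gcomp (E \<beta> i) g' g \<in> T (insert i \<beta>)"
      using assms g by (simp add: gcomp_T)
    show "gsrc (E \<beta> i) (gcomp (E \<beta> i) g' g) = gsrc (E \<beta> i) g"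
      using notin by (simp add: gsrc_E gcomp_E[OF assms(1)] fun_eq_iff)
    show "gtrg (E \<beta> i) (gcomp (E \<beta> i) g' g) = gtrg (E \<beta> i) g'"
      unfolding gtrg_E[OF c] gtrg_E[OF g(1)]
      using notin eq by (simp add: gcomp_E[OF assms(1)] fun_eq_iff)
  next
    fix g'' g' g
    assume g: "g'' \<in> T (insert i \<beta>)" "g' \<in> T (insert i \<beta>)" "g \<in> T (insert i \<beta>)"
    show "gcomp (E \<beta> i) g'' (gcomp (E \<beta> i) g' g) = gcomp (E \<beta> i) (gcomp (E \<beta> i) g'' g') g"
      using assms g[THEN T_carrier] by (auto simp: gcomp_E fun_eq_iff M.a_assoc)
  next
    fix g assume g: "g \<in> T (insert i \<beta>)"
    show "gcomp (E \<beta> i) g (gunit (E \<beta> i) (gsrc (E \<beta> i) g)) = g"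
      using assms T_carrier[OF g] T_undefined[OF g]
      by (auto simp: gcomp_E gunit_E gsrc_E fun_eq_iff subset_insert)
    show "gcomp (E \<beta> i) (gunit (E \<beta> i) (gtrg (E \<beta> i) g)) g = g"
      using assms T_carrier[OF g] T_undefined[OF g]
      by (auto simp: gcomp_E gunit_E gtrg_E[OF g] fun_eq_iff)
  next
    fix g assume g: "g \<in> T (insert i \<beta>)"
    \<comment> \<open>The inverse negates the components whose index contains \<open>i\<close> and
      keeps the others, since these record the common source and target.\<close>
    define h where "h = (\<lambda>\<gamma>\<in>Pow (insert i \<beta>). if i \<in> \<gamma> then \<ominus>\<^bsub>M\<^esub> g \<gamma> else g \<gamma>)"
    have h: "h \<in> T (insert i \<beta>)"
      using assms T_carrier[OF g] T_base[OF _ g] by (intro T_memI) (auto simp: h_def)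
    have restr: "restrict h (Pow \<beta>) = restrict g (Pow \<beta>)"
      using notin by (simp add: h_def fun_eq_iff)
    have "gcomp (E \<beta> i) h g = gunit (E \<beta> i) (restrict g (Pow \<beta>))"
      "gcomp (E \<beta> i) g h = gunit (E \<beta> i) (restrict g (Pow \<beta>))"
      using assms T_carrier[OF g]
      by (auto simp: gcomp_E gunit_E h_def fun_eq_iff subset_insert M.r_neg M.l_neg)
    then show "\<exists>h\<in>T (insert i \<beta>). gsrc (E \<beta> i) h = gtrg (E \<beta> i) g \<and>
        gtrg (E \<beta> i) h = gsrc (E \<beta> i) g \<and>
        gcomp (E \<beta> i) h g = gunit (E \<beta> i) (gsrc (E \<beta> i) g) \<and>
        gcomp (E \<beta> i) g h = gunit (E \<beta> i) (gtrg (E \<beta> i) g)"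
      using g h restr by (intro bexI[of _ h]) (auto simp: gsrc_E gtrg_E)
  qed
qed

section \<open>Squares as double groupoids\<close>

text \<open>The structure maps in direction \<open>i\<close> look only at whether \<open>i\<close>
  lies in the index, those in direction \<open>j\<close> only at \<open>j\<close>. Compatibility is
  therefore checked index by index over the four cases.\<close>

lemma structure_maps_hom_E:
  assumes "i \<notin> \<beta>" "j \<notin> \<beta>" "i \<noteq> j" "finite \<beta>"
  shows "structure_maps_hom (E (insert j \<beta>) i) (E \<beta> i) (E (insert i \<beta>) j) (E \<beta> j)"
proof -
  have fin: "finite (insert i \<beta>)" "finite (insert i (insert j \<beta>))"
    and notin: "i \<notin> insert j \<beta>" "j \<notin> insert i \<beta>"
    using assms by auto
  note comm = insert_commute[of j i]
  \<comment> \<open>Every index set in the square is described inside the top one by avoiding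
    \<open>i\<close> or \<open>j\<close>, which leaves only these membership tests after
    extensionality.\<close>
  have sub: "\<gamma> \<subseteq> insert i \<beta> \<longleftrightarrow> \<gamma> \<subseteq> insert i (insert j \<beta>) \<and> j \<notin> \<gamma>"
    "\<gamma> \<subseteq> insert j \<beta> \<longleftrightarrow> \<gamma> \<subseteq> insert i (insert j \<beta>) \<and> i \<notin> \<gamma>"
    "\<gamma> \<subseteq> \<beta> \<longleftrightarrow> \<gamma> \<subseteq> insert i (insert j \<beta>) \<and> i \<notin> \<gamma> \<and> j \<notin> \<gamma>" for \<gamma>
    using assms by auto
  have rest: "restrict v (Pow (insert i \<beta>)) \<in> T (insert i \<beta>)"
    if "v \<in> T (insert i (insert j \<beta>))" for v
    using that fin by (auto intro!: restrict_T[of _ "insert i (insert j \<beta>)"])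
  have rest0: "restrict v (Pow \<beta>) \<in> T \<beta>" if "v \<in> T (insert k \<beta>)" for v k
    using that assms(4) by (auto intro!: restrict_T[of _ "insert k \<beta>"])
  have src: "groupoid_hom (E (insert j \<beta>) i) (E \<beta> i) (\<lambda>v. restrict v (Pow (insert i \<beta>)))
      (\<lambda>v. restrict v (Pow \<beta>))"
    unfolding groupoid_hom_def Mor_E Obj_E
  proof (intro conjI ballI impI funcsetI)
    fix g assume g: "g \<in> T (insert i (insert j \<beta>))"
    show "gtrg (E \<beta> i) (restrict g (Pow (insert i \<beta>)))
        = restrict (gtrg (E (insert j \<beta>) i) g) (Pow \<beta>)"
      unfolding gtrg_E[OF g] gtrg_E[OF rest[OF g]]
      by (auto simp: restrict_def sub fun_eq_iff)
  qed (use assms notin in \<open>auto simp: rest rest0 gsrc_E gunit_E gcomp_E fun_eq_iff sub\<close>)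
  have trg: "groupoid_hom (E (insert j \<beta>) i) (E \<beta> i) (gtrg (E (insert i \<beta>) j)) (gtrg (E \<beta> j))"
    by (rule groupoid_hom_cong[OF src is_groupoid_E]) (use assms in \<open>auto simp: gtrg_E comm\<close>)
  have unit: "groupoid_hom (E \<beta> i) (E (insert j \<beta>) i) (gunit (E (insert i \<beta>) j)) (gunit (E \<beta> j))"
    unfolding groupoid_hom_def Mor_E Obj_E
  proof (intro conjI ballI impI funcsetI)
    fix g assume g: "g \<in> T (insert i \<beta>)"
    show u: "gunit (E (insert i \<beta>) j) g \<in> T (insert i (insert j \<beta>))"
      using gunit_T[OF notin(2) fin(1) g] by (simp add: comm)
    show "gtrg (E (insert j \<beta>) i) (gunit (E (insert i \<beta>) j) g) = gunit (E \<beta> j) (gtrg (E \<beta> i) g)"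
      unfolding gtrg_E[OF g] gtrg_E[OF u] using assms notin
      by (auto simp: gunit_E fun_eq_iff comm sub)
    show "gsrc (E (insert j \<beta>) i) (gunit (E (insert i \<beta>) j) g) = gunit (E \<beta> j) (gsrc (E \<beta> i) g)"
      unfolding gsrc_E using assms notin
      by (auto simp: gunit_E fun_eq_iff comm sub)
  next
    fix x assume "x \<in> T \<beta>"
    then show "gunit (E \<beta> j) x \<in> T (insert j \<beta>)"
      using assms by (simp add: gunit_T)
    show "gunit (E (insert i \<beta>) j) (gunit (E \<beta> i) x) = gunit (E (insert j \<beta>) i) (gunit (E \<beta> j) x)"
      using assms notin by (auto simp: gunit_E fun_eq_iff comm sub)
  next
    fix g' g
    show "gunit (E (insert i \<beta>) j) (gcomp (E \<beta> i) g' g)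
        = gcomp (E (insert j \<beta>) i) (gunit (E (insert i \<beta>) j) g') (gunit (E (insert i \<beta>) j) g)"
      using assms notin by (auto simp: gunit_E gcomp_E fun_eq_iff comm sub)
  qed
  have comp: "groupoid_hom
      (composable_pairs (E (insert j \<beta>) i) (E \<beta> i) (E (insert i \<beta>) j) (E \<beta> j))
      (E (insert j \<beta>) i)
      (\<lambda>(g', g). gcomp (E (insert i \<beta>) j) g' g) (\<lambda>(x', x). gcomp (E \<beta> j) x' x)"
  proof -
    let ?A = "T (insert i (insert j \<beta>))"
    have closed: "gcomp (E (insert i \<beta>) j) g' g \<in> ?A" if "g' \<in> ?A" "g \<in> ?A" for g' g
      using gcomp_T[OF notin(2) fin(1)] that by (simp add: comm)
    \<comment> \<open>At an index containing both \<open>i\<close> and \<open>j\<close> each side is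
      the sum of the same four components in a different order, so commutativity of addition is
      essential here.\<close>
    have interchange: "gcomp (E (insert i \<beta>) j) (gcomp (E (insert j \<beta>) i) h' g')
          (gcomp (E (insert j \<beta>) i) h g)
        = gcomp (E (insert j \<beta>) i) (gcomp (E (insert i \<beta>) j) h' h) (gcomp (E (insert i \<beta>) j) g' g)"
      if "h' \<in> ?A" "h \<in> ?A" "g' \<in> ?A" "g \<in> ?A" for h' h g' g
      using assms notin that[THEN T_carrier]
      by (auto simp: gcomp_E fun_eq_iff comm M.a_ac)
    have proj: "gtrg (E (insert j \<beta>) i) (gcomp (E (insert i \<beta>) j) g' g)
          = gcomp (E \<beta> j) (restrict g' (Pow (insert j \<beta>))) (restrict g (Pow (insert j \<beta>)))"
        "gsrc (E (insert j \<beta>) i) (gcomp (E (insert i \<beta>) j) g' g)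
          = gcomp (E \<beta> j) (restrict g' (Pow (insert j \<beta>))) (restrict g (Pow (insert j \<beta>)))"
      if "g' \<in> ?A" "g \<in> ?A" for g' g
      unfolding gtrg_E[OF closed[OF that]] gsrc_E using assms notin
      by (auto simp: gcomp_E fun_eq_iff comm sub)
    have units: "gcomp (E (insert i \<beta>) j) (gunit (E (insert j \<beta>) i) x') (gunit (E (insert j \<beta>) i) x)
        = gunit (E (insert j \<beta>) i) (gcomp (E \<beta> j) x' x)" for x' x
      using assms notin by (auto simp: gcomp_E gunit_E fun_eq_iff comm sub)
    show ?thesis
      unfolding groupoid_hom_def
      using assms
      by (auto simp: composable_pairs_def comm closed proj units gcomp_T
          intro!: interchange) (auto simp: gsrc_E gtrg_E)
  qed
  \<comment> \<open>\<open>structure_maps_hom\<close> mentions the projection as an unapplied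
    function, whereas \<open>src\<close> was proved for the explicit restriction map.\<close>
  have eta: "gsrc (E \<alpha> k) = (\<lambda>v. restrict v (Pow \<alpha>))" for \<alpha> k
    by (simp add: gsrc_E fun_eq_iff)
  show ?thesis
    unfolding structure_maps_hom_def using src trg unit comp by (simp add: eta)
qed

text \<open>The square is symmetric in its two directions, so the morphism conditions follow twice
  from one lemma, with \<open>i\<close> and \<open>j\<close> exchanged.\<close>

lemma double_groupoid_E:
  assumes "i \<notin> \<beta>" "j \<notin> \<beta>" "i \<noteq> j" "finite \<beta>"
  shows "double_groupoid (E (insert j \<beta>) i) (E \<beta> i) (E (insert i \<beta>) j) (E \<beta> j)"
  unfolding double_groupoid_def
  using assms structure_maps_hom_E[OF assms] structure_maps_hom_E[of j \<beta> i]
  by (auto simp: is_groupoid_E insert_commute[of i j])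

section \<open>Module structure on the vertex groups\<close>

text \<open>The vertex group at \<open>x\<close> consists of the extensions of \<open>x\<close> to
  \<open>Pow (insert i \<beta>)\<close>. Its free data are the components whose index contains
  \<open>i\<close>, and these range over the whole module; scalars act on them and leave the part
  given by \<open>x\<close> fixed.\<close>

lemma carries_module_vertex_group_E:
  assumes "i \<notin> \<beta>" "finite \<beta>" "x \<in> T \<beta>"
  shows "carries_module R (vertex_group (E \<beta> i) x)"
proof -
  let ?A = "vertex_group (E \<beta> i) x"
  \<comment> \<open>A module record has ring components; \<open>mult\<close> and \<open>one\<close> of \<open>N\<close> are junk.\<close>
  define N :: "('k, nat set \<Rightarrow> 'v) module" where
    "N = \<lparr>carrier = carrier ?A, monoid.mult = (\<lambda>v w. v), one = x, zero = one ?A,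
      add = monoid.mult ?A,
      smult = (\<lambda>a v. \<lambda>\<gamma>\<in>Pow (insert i \<beta>). if i \<in> \<gamma> then a \<odot>\<^bsub>M\<^esub> v \<gamma> else v \<gamma>)\<rparr>"
  have carrier_iff: "v \<in> carrier N \<longleftrightarrow>
      v \<in> T (insert i \<beta>) \<and> (\<forall>\<gamma>. \<gamma> \<subseteq> \<beta> \<longrightarrow> v \<gamma> = x \<gamma>)" for v
    using T_undefined[OF assms(3)]
    by (auto simp: N_def vertex_group_def gsrc_E gtrg_E fun_eq_iff)
  have add: "v \<oplus>\<^bsub>N\<^esub> w = gcomp (E \<beta> i) v w"
    and zero: "\<zero>\<^bsub>N\<^esub> = gunit (E \<beta> i) x"
    and smult: "a \<odot>\<^bsub>N\<^esub> v = (\<lambda>\<gamma>\<in>Pow (insert i \<beta>). if i \<in> \<gamma> then a \<odot>\<^bsub>M\<^esub> v \<gamma> else v \<gamma>)" for v w a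
    by (simp_all add: N_def vertex_group_def)
  have base: "v \<gamma> = x \<gamma>" if "v \<in> carrier N" "i \<notin> \<gamma>" "\<gamma> \<subseteq> insert i \<beta>" for v \<gamma>
    using that by (auto simp: carrier_iff subset_insert)
  have fibre: "v \<gamma> \<in> carrier M" if "v \<in> carrier N" "\<gamma> \<subseteq> insert i \<beta>" for v \<gamma>
    using that T_carrier[of v "insert i \<beta>" \<gamma>] by (simp add: carrier_iff)
  have undef: "v \<gamma> = undefined" if "v \<in> carrier N" "\<not> \<gamma> \<subseteq> insert i \<beta>" for v \<gamma>
    using that T_undefined[of v "insert i \<beta>" \<gamma>] by (simp add: carrier_iff)
  have N_memI: "v \<in> carrier N" if "\<And>\<gamma>. \<gamma> \<subseteq> insert i \<beta> \<Longrightarrow> i \<in> \<gamma> \<Longrightarrow> v \<gamma> \<in> carrier M"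
    "\<And>\<gamma>. \<gamma> \<subseteq> \<beta> \<Longrightarrow> v \<gamma> = x \<gamma>" "\<And>\<gamma>. \<not> \<gamma> \<subseteq> insert i \<beta> \<Longrightarrow> v \<gamma> = undefined" for v
    unfolding carrier_iff
  proof (intro conjI T_memI)
    show "v \<gamma> \<in> carrier M" if "\<gamma> \<subseteq> insert i \<beta>" for \<gamma>
      using that \<open>\<And>\<gamma>. \<gamma> \<subseteq> insert i \<beta> \<Longrightarrow> i \<in> \<gamma> \<Longrightarrow> v \<gamma> \<in> carrier M\<close>
        \<open>\<And>\<gamma>. \<gamma> \<subseteq> \<beta> \<Longrightarrow> v \<gamma> = x \<gamma>\<close> T_carrier[OF assms(3)]
      by (cases "i \<in> \<gamma>") (auto simp: subset_insert)
  qed (use that assms T_base[OF assms(2,3)] in auto)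
  \<comment> \<open>Components avoiding \<open>i\<close> are prescribed by \<open>x\<close>, and
    those outside the index set are \<open>undefined\<close>. The module laws thus need checking
    only where \<open>i\<close> lies in the index, and there they are laws of
    \<open>M\<close>.\<close>
  have N_eqI: "v = w" if "v \<in> carrier N" "w \<in> carrier N"
    "\<And>\<gamma>. \<gamma> \<subseteq> insert i \<beta> \<Longrightarrow> i \<in> \<gamma> \<Longrightarrow> v \<gamma> = w \<gamma>" for v w
    using that base undef by (metis ext)
  have notin: "i \<notin> \<gamma>" "\<gamma> \<subseteq> insert i \<beta>" if "\<gamma> \<subseteq> \<beta>" for \<gamma>
    using that assms(1) by auto
  have add_closed: "v \<oplus>\<^bsub>N\<^esub> w \<in> carrier N" if "v \<in> carrier N" "w \<in> carrier N" for v w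
    using that assms(1) notin by (intro N_memI) (auto simp: add gcomp_E fibre base)
  have smult_closed: "a \<odot>\<^bsub>N\<^esub> v \<in> carrier N" if "a \<in> carrier R" "v \<in> carrier N" for a v
    using that assms(1) notin by (intro N_memI) (auto simp: smult fibre base)
  have zero_closed: "\<zero>\<^bsub>N\<^esub> \<in> carrier N"
    using assms(1) notin by (intro N_memI) (auto simp: zero gunit_E)
  \<comment> \<open>The summands are swapped because \<open>gcomp\<close> puts the component of its
    second argument first.\<close>
  have apply_simps: "(v \<oplus>\<^bsub>N\<^esub> w) \<gamma> = w \<gamma> \<oplus>\<^bsub>M\<^esub> v \<gamma>" "(a \<odot>\<^bsub>N\<^esub> v) \<gamma> = a \<odot>\<^bsub>M\<^esub> v \<gamma>"
    "\<zero>\<^bsub>N\<^esub> \<gamma> = \<zero>\<^bsub>M\<^esub>"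
    if "\<gamma> \<subseteq> insert i \<beta>" "i \<in> \<gamma>" for v w a \<gamma>
    using that assms(1) by (simp_all add: add smult zero gcomp_E gunit_E)
  note [simp] = add_closed smult_closed zero_closed
  have "abelian_group N"
  proof (rule abelian_groupI)
    fix v assume v: "v \<in> carrier N"
    define w where "w = (\<lambda>\<gamma>\<in>Pow (insert i \<beta>). if i \<in> \<gamma> then \<ominus>\<^bsub>M\<^esub> v \<gamma> else v \<gamma>)"
    have w: "w \<in> carrier N"
      using v notin by (intro N_memI) (auto simp: w_def fibre base)
    moreover have "w \<oplus>\<^bsub>N\<^esub> v = \<zero>\<^bsub>N\<^esub>"
      using v w by (intro N_eqI) (simp_all add: apply_simps, simp add: w_def fibre M.r_neg)
    ultimately show "\<exists>w\<in>carrier N. w \<oplus>\<^bsub>N\<^esub> v = \<zero>\<^bsub>N\<^esub>"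
      by blast
  next
    show "v \<oplus>\<^bsub>N\<^esub> w \<oplus>\<^bsub>N\<^esub> u = v \<oplus>\<^bsub>N\<^esub> (w \<oplus>\<^bsub>N\<^esub> u)"
      if "v \<in> carrier N" "w \<in> carrier N" "u \<in> carrier N" for v w u
      using that by (intro N_eqI) (simp_all add: apply_simps fibre M.a_assoc)
    show "v \<oplus>\<^bsub>N\<^esub> w = w \<oplus>\<^bsub>N\<^esub> v" if "v \<in> carrier N" "w \<in> carrier N" for v w
      using that by (intro N_eqI) (simp_all add: apply_simps fibre M.a_comm)
    show "\<zero>\<^bsub>N\<^esub> \<oplus>\<^bsub>N\<^esub> v = v" if "v \<in> carrier N" for v
      using that by (intro N_eqI) (simp_all add: apply_simps fibre)
  qed simp_all
  then have "module R N"
    by (intro moduleI R.is_cring N_eqI)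
      (simp_all add: apply_simps fibre smult_l_distr smult_r_distr smult_assoc1 M.a_comm)
  then show ?thesis
    unfolding carries_module_def by (intro exI[of _ N]) (simp add: N_def)
qed

section \<open>Action of permutations\<close>

text \<open>The preimage of the empty set is empty, so the base component is unchanged and stays in
  \<open>U\<close>.\<close>

lemma reindex_T:
  assumes "bij \<tau>" "finite \<alpha>" "x \<in> T \<alpha>"
  shows "(\<lambda>\<gamma>. x (\<tau> -` \<gamma>)) \<in> T (\<tau> ` \<alpha>)"
  using assms T_base[OF assms(2,3)] T_carrier[OF assms(3)] T_undefined[OF assms(3)]
  by (intro T_memI) (auto simp flip: vimage_subset_iff)

lemma bij_betw_reindex_T:
  assumes "bij \<tau>" "finite \<alpha>"
  shows "bij_betw (\<lambda>x \<gamma>. x (\<tau> -` \<gamma>)) (T \<alpha>) (T (\<tau> ` \<alpha>))"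
proof (rule bij_betw_byWitness[where f' = "\<lambda>x \<gamma>. x (\<tau> ` \<gamma>)"])
  \<comment> \<open>The candidate inverse reindexes along images under \<open>\<tau>\<close>, which
    are preimages under \<open>inv \<tau>\<close>; so the previous lemma applies to
    \<open>inv \<tau>\<close>.\<close>
  have "(\<lambda>\<gamma>. x (\<tau> ` \<gamma>)) \<in> T \<alpha>" if "x \<in> T (\<tau> ` \<alpha>)" for x
    using reindex_T[OF bij_imp_bij_inv[OF assms(1)] _ that] assms
    by (simp add: bij_vimage_eq_inv_image bij_imp_bij_inv inv_inv_eq image_inv_f_f bij_is_inj)
  then show "(\<lambda>x \<gamma>. x (\<tau> ` \<gamma>)) ` T (\<tau> ` \<alpha>) \<subseteq> T \<alpha>"
    by blast
qed (use assms in \<open>auto simp: inj_vimage_image_eq surj_image_vimage_eq bij_is_inj bij_is_surj reindex_T\<close>)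

text \<open>The structure maps refer to an index only through inclusions and through membership of
  \<open>i\<close>. Taking preimages under a bijection carries both over, with
  \<open>\<tau> i\<close> in the role of \<open>i\<close>.\<close>

lemma groupoid_hom_reindex:
  assumes "bij \<tau>" "i \<notin> \<beta>" "finite \<beta>"
  shows "groupoid_hom (E \<beta> i) (E (\<tau> ` \<beta>) (\<tau> i)) (\<lambda>x \<gamma>. x (\<tau> -` \<gamma>)) (\<lambda>x \<gamma>. x (\<tau> -` \<gamma>))"
  unfolding groupoid_hom_def Mor_E Obj_E
proof (intro conjI ballI impI funcsetI)
  have notin: "\<tau> i \<notin> \<tau> ` \<beta>"
    using assms by (simp add: bij_is_inj inj_image_mem_iff)
  have sub: "\<gamma> \<subseteq> insert (\<tau> i) (\<tau> ` \<beta>) \<longleftrightarrow> \<tau> -` \<gamma> \<subseteq> insert i \<beta>"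
    "\<gamma> \<subseteq> \<tau> ` \<beta> \<longleftrightarrow> \<tau> -` \<gamma> \<subseteq> \<beta>" for \<gamma>
    using assms(1) by (simp_all add: vimage_subset_iff)
  fix g assume g: "g \<in> T (insert i \<beta>)"
  show g1: "(\<lambda>\<gamma>. g (\<tau> -` \<gamma>)) \<in> T (insert (\<tau> i) (\<tau> ` \<beta>))"
    using reindex_T[OF assms(1) _ g] assms by simp
  show "gsrc (E (\<tau> ` \<beta>) (\<tau> i)) (\<lambda>\<gamma>. g (\<tau> -` \<gamma>)) = (\<lambda>\<gamma>. gsrc (E \<beta> i) g (\<tau> -` \<gamma>))"
    by (simp add: gsrc_E restrict_def sub)
  show "gtrg (E (\<tau> ` \<beta>) (\<tau> i)) (\<lambda>\<gamma>. g (\<tau> -` \<gamma>)) = (\<lambda>\<gamma>. gtrg (E \<beta> i) g (\<tau> -` \<gamma>))"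
    unfolding gtrg_E[OF g] gtrg_E[OF g1] by (simp add: restrict_def sub)
  show "(\<lambda>\<gamma>. gcomp (E \<beta> i) g' g (\<tau> -` \<gamma>))
      = gcomp (E (\<tau> ` \<beta>) (\<tau> i)) (\<lambda>\<gamma>. g' (\<tau> -` \<gamma>)) (\<lambda>\<gamma>. g (\<tau> -` \<gamma>))" for g'
    using assms(2) notin by (simp add: gcomp_E fun_eq_iff sub)
next
  fix x assume x: "x \<in> T \<beta>"
  show "(\<lambda>\<gamma>. x (\<tau> -` \<gamma>)) \<in> T (\<tau> ` \<beta>)"
    using reindex_T[OF assms(1,3) x] .
  show "(\<lambda>\<gamma>. gunit (E \<beta> i) x (\<tau> -` \<gamma>)) = gunit (E (\<tau> ` \<beta>) (\<tau> i)) (\<lambda>\<gamma>. x (\<tau> -` \<gamma>))"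
    using assms by (simp add: gunit_E fun_eq_iff vimage_subset_iff bij_is_inj inj_image_mem_iff
        flip: image_insert)
qed

section \<open>The tangent bundle as a symmetric n-fold vector bundle\<close>

lemma n_fold_groupoid_tangent_bundle: "n_fold_groupoid n (tangent_bundle R M U)"
  unfolding n_fold_groupoid_def tangent_bundle_def Gsy_def
  by (auto simp: is_groupoid_E finite_subset intro!: double_groupoid_E)

lemma edge_symmetric_tangent_bundle: "edge_symmetric n (tangent_bundle R M U)"
  unfolding edge_symmetric_def tangent_bundle_def Gsy_def
\<comment> \<open>The same formula serves at every vertex. Preimages reverse composition and
  precomposition reverses it again, so the action law comes out in the required order.\<close>
proof (intro exI[of _ "\<lambda>\<tau> \<alpha> x \<gamma>. x (\<tau> -` \<gamma>)"] conjI allI impI)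
  fix \<tau> assume "\<tau> permutes {1..n}"
  then have "bij \<tau>"
    by (rule permutes_bij)
  then show "n_fold_iso n \<lparr>vertex = T, edge = E\<rparr> (permuted \<tau> \<lparr>vertex = T, edge = E\<rparr>)
      (\<lambda>\<alpha> x \<gamma>. x (\<tau> -` \<gamma>))"
    unfolding n_fold_iso_def permuted_def
    by (auto intro!: bij_betw_reindex_T groupoid_hom_reindex intro: finite_subset)
qed (simp_all add: vimage_comp comp_def)

lemma symmetric_n_fold_vector_bundle_tangent_bundle:
  "symmetric_n_fold_vector_bundle R n (tangent_bundle R M U)"
  unfolding symmetric_n_fold_vector_bundle_def
proof (intro conjI allI impI ballI)
  fix \<beta> i assume "\<beta> \<subseteq> {1..n} \<and> i \<in> {1..n} - \<beta>"
  then have \<beta>: "i \<notin> \<beta>" "finite \<beta>"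
    by (auto intro: finite_subset)
  {
    fix g assume "g \<in> Mor (edge (tangent_bundle R M U) \<beta> i)"
    then show "gsrc (edge (tangent_bundle R M U) \<beta> i) g = gtrg (edge (tangent_bundle R M U) \<beta> i) g"
      by (simp add: tangent_bundle_def Gsy_def gsrc_E gtrg_E)
  next
    fix x assume "x \<in> Obj (edge (tangent_bundle R M U) \<beta> i)"
    then show "carries_module R (vertex_group (edge (tangent_bundle R M U) \<beta> i) x)"
      using \<beta> by (simp add: tangent_bundle_def Gsy_def carries_module_vertex_group_E)
  }
qed (rule n_fold_groupoid_tangent_bundle edge_symmetric_tangent_bundle)+

end

theorem theorem4p7:
  fixes K :: "('k, 'm) ring_scheme"
    and V :: "('k, 'v, 'n) module_scheme"
    and U :: "'v set"
    and n :: nat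
  assumes "cring K"
    and "linear_set K V U"
  shows "symmetric_n_fold_vector_bundle K n (tangent_bundle K V U)"
proof -
  interpret module_with_set K V U
    using assms by (simp add: linear_set_def module_with_set_def)
  show ?thesis
    by (rule symmetric_n_fold_vector_bundle_tangent_bundle)
qed

end
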